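(* For every $n \ge 1$ there exists a directed graph $G$ on $3n$ vertices (with a suitable weight function) such that any path-comparison based algorithm which correctly computes betweenness centrality of all vertices on every input weight function for $G$ must perform at least $n^3/2$ path weight comparisons on some weight function for $G$.
   Context: A path-comparison based algorithm accepts as input a graph $G$ and an edge-weight function; it may perform all standard operations, but the only way it can access the edge weights is by comparing the total weights of two different paths. For a (directed) graph with positive edge weights, $\lambda_{st}$ denotes the number of shortest (minimum total weight) paths from $s$ to $t$, $\lambda_{st}(v)$ the number of those passing through $v$, and the betweenness centrality of $v$ is $BC(v)=\sum_{s,t:\, s\neq v\neq t} \lambda_{st}(v)/\lambda_{st}$ (sum over pairs with $t$ reachable from $s$). *)

theory Defs
  imports Complex_Main
begin

definition is_path :: "nat set \<Rightarrow> (nat \<times> nat) set \<Rightarrow> nat list \<Rightarrow> bool" where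
  "is_path V E p \<longleftrightarrow> p \<noteq> [] \<and> distinct p \<and> set p \<subseteq> V \<and>
     (\<forall>i. Suc i < length p \<longrightarrow> (p ! i, p ! Suc i) \<in> E)"

definition paths_st :: "nat set \<Rightarrow> (nat \<times> nat) set \<Rightarrow> nat \<Rightarrow> nat \<Rightarrow> nat list set" where
  "paths_st V E s t = {p. is_path V E p \<and> hd p = s \<and> last p = t}"

definition path_weight :: "(nat \<times> nat \<Rightarrow> real) \<Rightarrow> nat list \<Rightarrow> real" where
  "path_weight w p = (\<Sum>i<length p - 1. w (p ! i, p ! Suc i))"

definition pos_weights :: "(nat \<times> nat) set \<Rightarrow> (nat \<times> nat \<Rightarrow> real) \<Rightarrow> bool" where
  "pos_weights E w \<longleftrightarrow> (\<forall>e\<in>E. w e > 0)"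

definition shortest_paths :: "nat set \<Rightarrow> (nat \<times> nat) set \<Rightarrow> (nat \<times> nat \<Rightarrow> real) \<Rightarrow> nat \<Rightarrow> nat \<Rightarrow> nat list set" where
  "shortest_paths V E w s t =
     {p \<in> paths_st V E s t. \<forall>q \<in> paths_st V E s t. path_weight w p \<le> path_weight w q}"

definition num_sp :: "nat set \<Rightarrow> (nat \<times> nat) set \<Rightarrow> (nat \<times> nat \<Rightarrow> real) \<Rightarrow> nat \<Rightarrow> nat \<Rightarrow> nat" where
  "num_sp V E w s t = card (shortest_paths V E w s t)"

definition num_sp_through :: "nat set \<Rightarrow> (nat \<times> nat) set \<Rightarrow> (nat \<times> nat \<Rightarrow> real) \<Rightarrow> nat \<Rightarrow> nat \<Rightarrow> nat \<Rightarrow> nat" where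
  "num_sp_through V E w s t v = card {p \<in> shortest_paths V E w s t. v \<in> set p}"

definition betweenness :: "nat set \<Rightarrow> (nat \<times> nat) set \<Rightarrow> (nat \<times> nat \<Rightarrow> real) \<Rightarrow> nat \<Rightarrow> real" where
  "betweenness V E w v =
     (\<Sum>(s,t) \<in> {(s,t). s \<in> V \<and> t \<in> V \<and> s \<noteq> v \<and> t \<noteq> v \<and> paths_st V E s t \<noteq> {}}.
        real (num_sp_through V E w s t v) / real (num_sp V E w s t))"

text \<open>Path-comparison based algorithms on a fixed graph, modelled as ternary decision trees:
each internal node compares the total weights of two (different) paths and branches on
<, =, >; each leaf outputs a value for every vertex.\<close>

datatype cmp_tree =
    Leaf "nat \<Rightarrow> real"
  | Query "nat list" "nat list" cmp_tree cmp_tree cmp_tree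

fun run_tree :: "cmp_tree \<Rightarrow> (nat \<times> nat \<Rightarrow> real) \<Rightarrow> nat \<Rightarrow> real" where
  "run_tree (Leaf f) w = f"
| "run_tree (Query p q tlt tet tgt) w =
     (if path_weight w p < path_weight w q then run_tree tlt w
      else if path_weight w p = path_weight w q then run_tree tet w
      else run_tree tgt w)"

fun num_comparisons :: "cmp_tree \<Rightarrow> (nat \<times> nat \<Rightarrow> real) \<Rightarrow> nat" where
  "num_comparisons (Leaf f) w = 0"
| "num_comparisons (Query p q tlt tet tgt) w =
     Suc (if path_weight w p < path_weight w q then num_comparisons tlt w
      else if path_weight w p = path_weight w q then num_comparisons tet w
      else num_comparisons tgt w)"

fun valid_tree :: "nat set \<Rightarrow> (nat \<times> nat) set \<Rightarrow> cmp_tree \<Rightarrow> bool" where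
  "valid_tree V E (Leaf f) = True"
| "valid_tree V E (Query p q tlt tet tgt) =
     (is_path V E p \<and> is_path V E q \<and> p \<noteq> q \<and>
      valid_tree V E tlt \<and> valid_tree V E tet \<and> valid_tree V E tgt)"

definition computes_BC :: "nat set \<Rightarrow> (nat \<times> nat) set \<Rightarrow> cmp_tree \<Rightarrow> bool" where
  "computes_BC V E T \<longleftrightarrow>
     (\<forall>w. pos_weights E w \<longrightarrow> (\<forall>v \<in> V. run_tree T w v = betweenness V E w v))"

end

(* Take the complete tripartite digraph U -> M -> W with all edges U -> W added, and give the edge
   (s,t) a large multiple of 2^t - 2^s plus a small term. The numbers 2^t - 2^s with s < t are
   distinct, so comparing paths with different end points only sees the large terms. Among the
   paths from x in U to z in W the small terms make the edge (x,z) shortest, followed by the paths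
   x,y,z in the order of y, so that no vertex lies inside a shortest path. For every i,j,k there are other
   small terms under which i,j,k becomes the shortest path from i to k, while the order of any
   two paths is preserved unless i,j,k was the longer of them. Hence each of the n^3 paths i,j,k
   must occur as the longer path of some comparison. *)
theory Submission
  imports Defs
begin

section \<open>Comparisons made by a decision tree\<close>

fun queries :: "cmp_tree \<Rightarrow> (nat \<times> nat \<Rightarrow> real) \<Rightarrow> (nat list \<times> nat list) set" where
  "queries (Leaf f) w = {}"
| "queries (Query p q tlt tet tgt) w =
     insert (p, q)
      (if path_weight w p < path_weight w q then queries tlt w
       else if path_weight w p = path_weight w q then queries tet w
       else queries tgt w)"

lemma finite_queries: "finite (queries T w)"
  by (induction T) auto

lemma card_queries_le: "card (queries T w) \<le> num_comparisons T w"
  by (induction T) (auto simp: card_insert_if finite_queries)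

lemma queries_paths:
  assumes "valid_tree V E T" "(p, q) \<in> queries T w"
  shows "is_path V E p \<and> is_path V E q"
  using assms
proof (induction T)
  case (Query p' q' tlt tet tgt)
  then show ?case
    by (cases "path_weight w p'" "path_weight w q'" rule: linorder_cases) auto
qed simp

text \<open>By induction: both weights choose the same branch at the root, and the comparisons made
  in that branch again belong to \<open>queries T w\<close>. Agreement is needed only along the run
  for \<open>w\<close>.\<close>

lemma run_tree_cong:
  assumes "\<And>p q. (p, q) \<in> queries T w \<Longrightarrow>
    (path_weight w p < path_weight w q \<longleftrightarrow> path_weight w' p < path_weight w' q) \<and>
    (path_weight w p = path_weight w q \<longleftrightarrow> path_weight w' p = path_weight w' q)"
  shows "run_tree T w = run_tree T w'"
  using assms
proof (induction T)
  case (Query p q tlt tet tgt)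
  have root: "(path_weight w p < path_weight w q \<longleftrightarrow> path_weight w' p < path_weight w' q) \<and>
    (path_weight w p = path_weight w q \<longleftrightarrow> path_weight w' p = path_weight w' q)"
    by (rule Query.prems) simp
  show ?case
  proof (cases "path_weight w p" "path_weight w q" rule: linorder_cases)
    case less
    have "run_tree tlt w = run_tree tlt w'"
      by (intro Query.IH Query.prems) (use less in simp)
    then show ?thesis
      using less root by simp
  next
    case equal
    have "run_tree tet w = run_tree tet w'"
      by (intro Query.IH Query.prems) (use equal in simp)
    then show ?thesis
      using equal root by simp
  next
    case greater
    have "run_tree tgt w = run_tree tgt w'"
      by (intro Query.IH Query.prems) (use greater in simp)
    then show ?thesis
      using greater root by simp
  qed
qed simp

section \<open>The graph and its paths\<close>

definition tri_edges :: "nat \<Rightarrow> (nat \<times> nat) set" where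
  "tri_edges n =
     {(s, t). (s < n \<and> n \<le> t \<and> t < 3 * n) \<or> (n \<le> s \<and> s < 2 * n \<and> 2 * n \<le> t \<and> t < 3 * n)}"

abbreviation tri_path :: "nat \<Rightarrow> nat list \<Rightarrow> bool" where
  "tri_path n \<equiv> is_path {..<3 * n} (tri_edges n)"

text \<open>The vertices form three blocks [0,n), [n,2n), [2n,3n) and every edge leads to a later
  block, so there is no path on four vertices.\<close>

lemma tri_path_cases:
  assumes "tri_path n p"
  obtains (vertex) x where "p = [x]"
  | (edge) s t where "p = [s, t]" "(s, t) \<in> tri_edges n"
  | (long) x y z where "p = [x, y, z]" "x < n" "n \<le> y" "y < 2 * n" "2 * n \<le> z" "z < 3 * n"
proof -
  have step: "(p ! i, p ! Suc i) \<in> tri_edges n" if "Suc i < length p" for i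
    using assms that by (auto simp: is_path_def)
  have "p \<noteq> []"
    using assms by (auto simp: is_path_def)
  then consider x where "p = [x]" | s t where "p = [s, t]" | x y z where "p = [x, y, z]"
    | a b c d r where "p = a # b # c # d # r"
    by (metis neq_Nil_conv)
  then show thesis
  proof cases
    case 1
    then show ?thesis by (rule vertex)
  next
    case 2
    then show ?thesis using step[of 0] by (auto intro: edge)
  next
    case 3
    then show ?thesis using step[of 0] step[of 1] by (auto simp: tri_edges_def intro: long)
  next
    case 4
    then show ?thesis using step[of 0] step[of 1] step[of 2]
      by (auto simp: tri_edges_def numeral_2_eq_2)
  qed
qed

text \<open>Ends determine a path unless it runs from the first block to the last; there it is
  either the direct edge or a detour through one middle vertex.\<close>

lemma same_ends_cases:
  assumes "tri_path n p" "tri_path n q" "hd p = hd q" "last p = last q"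
  shows "p = q
    \<or> (\<exists>x y z. x < n \<and> n \<le> y \<and> y < 2 * n \<and> 2 * n \<le> z \<and> p = [x, z] \<and> q = [x, y, z])
    \<or> (\<exists>x y z. x < n \<and> n \<le> y \<and> y < 2 * n \<and> 2 * n \<le> z \<and> p = [x, y, z] \<and> q = [x, z])
    \<or> (\<exists>x y y' z. x < n \<and> n \<le> y \<and> y < 2 * n \<and> n \<le> y' \<and> y' < 2 * n \<and> 2 * n \<le> z
        \<and> p = [x, y, z] \<and> q = [x, y', z])"
  using assms(1)
proof (cases rule: tri_path_cases)
  case vertex
  from assms(2) show ?thesis
    by (cases rule: tri_path_cases) (use vertex assms(3,4) in \<open>auto simp: tri_edges_def\<close>)
next
  case edge
  from assms(2) show ?thesis
    by (cases rule: tri_path_cases) (use edge assms(3,4) in \<open>auto simp: tri_edges_def\<close>)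
next
  case long
  from assms(2) show ?thesis
    by (cases rule: tri_path_cases) (use long assms(3,4) in \<open>auto simp: tri_edges_def\<close>)
qed

lemma tri_path_edge: "(s, t) \<in> tri_edges n \<Longrightarrow> tri_path n [s, t]"
  by (auto simp: is_path_def tri_edges_def)

lemma tri_path_long:
  assumes "x < n" "n \<le> y" "y < 2 * n" "2 * n \<le> z" "z < 3 * n"
  shows "tri_path n [x, y, z]"
  using assms by (auto simp: is_path_def tri_edges_def less_Suc_eq)

lemma finite_shortest_paths:
  assumes "finite V"
  shows "finite (shortest_paths V E w s t)"
  by (rule finite_subset[OF _ finite_subset_distinct[OF assms]])
    (auto simp: shortest_paths_def paths_st_def is_path_def)

lemma path_weight_simps [simp]:
  "path_weight w [x] = 0"
  "path_weight w [s, t] = w (s, t)"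
  "path_weight w [x, y, z] = w (x, y) + w (y, z)"
  by (simp_all add: path_weight_def numeral_2_eq_2)

section \<open>The weights\<close>

text \<open>The sum of 2^t - 2^s over the edges (s,t) of a path telescopes to this value, so the
  large term of \<open>weight\<close> sees only the end points.\<close>

definition span :: "nat list \<Rightarrow> real" where
  "span p = 2 ^ last p - 2 ^ hd p"

text \<open>Both t and s' are at most t' - 1, so 2^t + 2^s' is at most 2^t'; the gap of 1 comes from
  2^s being at least 1.\<close>

lemma power_diff_less:
  fixes s t s' t' :: nat
  assumes "t < t'" "s' < t'"
  shows "(2::real) ^ t - 2 ^ s + 1 \<le> 2 ^ t' - 2 ^ s'"
proof -
  obtain m where m: "t' = Suc m"
    using assms by (cases t') auto
  have "(2::real) ^ t \<le> 2 ^ m" "(2::real) ^ s' \<le> 2 ^ m" "(1::real) \<le> 2 ^ s"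
    using assms m by (auto intro: power_increasing)
  then have "2 ^ t - 2 ^ s + 1 \<le> (2::real) ^ m + 2 ^ m - 2 ^ s'"
    by linarith
  then show ?thesis
    by (simp add: m)
qed

lemma power_diff_step:
  assumes "s < t"
  shows "(2::real) ^ s + 1 \<le> 2 ^ t"
  using power_diff_less[OF assms assms, of s] by simp

text \<open>The differences are ordered by t first and, for equal t, by decreasing s.\<close>

lemma power_diff_separated:
  fixes s t s' t' :: nat
  assumes "s < t" "s' < t'"
  shows "(s, t) = (s', t') \<or> (2::real) ^ t - 2 ^ s + 1 \<le> 2 ^ t' - 2 ^ s'
    \<or> (2::real) ^ t' - 2 ^ s' + 1 \<le> 2 ^ t - 2 ^ s"
proof (cases "t = t'")
  case True
  then show ?thesis
    using power_diff_step[of s s'] power_diff_step[of s' s] by (cases s s' rule: linorder_cases) auto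
next
  case False
  then show ?thesis
    using power_diff_less[of t t' s' s] power_diff_less[of t' t s s'] assms
    by (cases t t' rule: linorder_cases) auto
qed

text \<open>All one-vertex paths have span 0, so their ends cannot be told apart. This exception is
  harmless: their weight is 0 under every weight function.\<close>

lemma span_separated:
  assumes "tri_path n p" "tri_path n q"
  shows "(\<exists>x y. p = [x] \<and> q = [y]) \<or> (hd p = hd q \<and> last p = last q)
    \<or> span p + 1 \<le> span q \<or> span q + 1 \<le> span p"
proof -
  have *: "(\<exists>x. r = [x]) \<or> hd r < last r" if "tri_path n r" for r
    using that by (cases rule: tri_path_cases) (auto simp: tri_edges_def)
  consider x y where "p = [x]" "q = [y]" | x where "p = [x]" "hd q < last q"
    | y where "q = [y]" "hd p < last p" | "hd p < last p" "hd q < last q"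
    using *[OF assms(1)] *[OF assms(2)] by blast
  then show ?thesis
  proof cases
    case 1
    then show ?thesis by blast
  next
    case 2
    then show ?thesis using power_diff_step[of "hd q" "last q"] by (simp add: span_def)
  next
    case 3
    then show ?thesis using power_diff_step[of "hd p" "last p"] by (simp add: span_def)
  next
    case 4
    then show ?thesis using power_diff_separated by (auto simp: span_def)
  qed
qed

text \<open>With small terms of absolute value at most 21n on every path, two paths differ by at
  most 42n there. The factor 100n thus lets a gap of 1 in \<open>span\<close> decide a comparison,
  and it keeps the edge weights positive.\<close>

definition weight :: "nat \<Rightarrow> (nat \<times> nat \<Rightarrow> real) \<Rightarrow> nat \<times> nat \<Rightarrow> real" where
  "weight n \<sigma> e = 100 * real n * (2 ^ snd e - 2 ^ fst e) + \<sigma> e"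

lemma path_weight_weight:
  assumes "tri_path n p"
  shows "path_weight (weight n \<sigma>) p = 100 * real n * span p + path_weight \<sigma> p"
  using assms by (cases rule: tri_path_cases) (simp_all add: weight_def span_def algebra_simps)

definition base :: "nat \<Rightarrow> nat \<times> nat \<Rightarrow> real" where
  "base n e = (if fst e < n \<and> snd e < 2 * n then real (snd e) else 0)"

(* The paths x,j,z get the small terms -2j, 2j and 6j according as both, one or none of x = i and
   z = k hold. The paths through y < j are below 2j, those through y > j above 6j. *)
definition shifted :: "nat \<Rightarrow> nat \<Rightarrow> nat \<Rightarrow> nat \<Rightarrow> nat \<times> nat \<Rightarrow> real" where
  "shifted n i j k e =
     (if fst e < n \<and> snd e < 2 * n
      then (if snd e < j then real (snd e)
            else if snd e = j then (if fst e = i then - real j else 3 * real j)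
            else 6 * real j + real (snd e))
      else if fst e = j then (if snd e = k then - real j else 3 * real j) else 0)"

lemma base_bound:
  assumes "tri_path n p"
  shows "\<bar>path_weight (base n) p\<bar> \<le> 21 * real n"
  using assms by (cases rule: tri_path_cases) (auto simp: base_def)

text \<open>The largest possible value is 6j + y, which is below 14n; the bound 21n is
  generous.\<close>

lemma shifted_bound:
  assumes "tri_path n p" "j < 2 * n"
  shows "\<bar>path_weight (shifted n i j k) p\<bar> \<le> 21 * real n"
  using assms by (cases rule: tri_path_cases) (auto simp: shifted_def)

text \<open>Edges through j are shared by many paths, so i,j,k cannot be lowered by its edges alone:
  with -j for a match and 3j otherwise, a single match still sums to 2j > 0. The paths through y > j
  are lifted by 6j to stay on top.\<close>

lemma small_weights:
  assumes "x < n" "n \<le> y" "y < 2 * n" "2 * n \<le> z" "n \<le> j" "j < 2 * n"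
  shows "path_weight (base n) [x, z] = 0" "path_weight (base n) [x, y, z] = real y"
    "path_weight (shifted n i j k) [x, z] = 0"
    "path_weight (shifted n i j k) [x, y, z] =
      (if y < j then real y else if y > j then 6 * real j + real y
       else if x = i \<and> z = k then - 2 * real j
       else if x = i \<or> z = k then 2 * real j else 6 * real j)"
  using assms by (simp_all add: base_def shifted_def)

lemma pos_weights_weight:
  assumes "n \<ge> 1" "\<And>p. tri_path n p \<Longrightarrow> \<bar>path_weight \<sigma> p\<bar> \<le> 21 * real n"
  shows "pos_weights (tri_edges n) (weight n \<sigma>)"
  unfolding pos_weights_def
proof
  fix e assume "e \<in> tri_edges n"
  then obtain s t where e: "e = (s, t)" "(s, t) \<in> tri_edges n"
    by (cases e) auto
  then have "s < t"
    by (auto simp: tri_edges_def)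
  then have "100 * real n \<le> 100 * real n * (2 ^ t - 2 ^ s)"
    using power_diff_step[of s t] mult_left_mono[of 1 "2 ^ t - 2 ^ s" "100 * real n"] by linarith
  moreover have "\<bar>\<sigma> (s, t)\<bar> \<le> 21 * real n"
    using assms(2)[OF tri_path_edge[OF e(2)]] by simp
  ultimately show "weight n \<sigma> e > 0"
    using assms(1) unfolding weight_def e fst_conv snd_conv by linarith
qed

lemma span_less_imp_weight_less:
  assumes "n \<ge> 1" "tri_path n p" "tri_path n q" "span p + 1 \<le> span q"
    and "\<bar>path_weight \<sigma> p\<bar> \<le> 21 * real n" "\<bar>path_weight \<sigma> q\<bar> \<le> 21 * real n"
  shows "path_weight (weight n \<sigma>) p < path_weight (weight n \<sigma>) q"
proof -
  have "100 * real n * (span p + 1) \<le> 100 * real n * span q"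
    using assms by (intro mult_left_mono) auto
  then show ?thesis
    using assms by (simp add: path_weight_weight algebra_simps)
qed

text \<open>For different ends \<open>span\<close> decides under both weights. For equal ends the
  values in \<open>small_weights\<close> keep their order, except that i,j,k drops below all its
  rivals; this cannot hurt when it was already the shorter path. Ties occur only between equal paths
  or one-vertex paths, so they always survive.\<close>

lemma shifted_preserves_order:
  assumes "n \<ge> 1" "n \<le> j" "j < 2 * n" "tri_path n p" "tri_path n q"
  shows "path_weight (weight n (base n)) p < path_weight (weight n (base n)) q \<Longrightarrow> q \<noteq> [i, j, k] \<Longrightarrow>
      path_weight (weight n (shifted n i j k)) p < path_weight (weight n (shifted n i j k)) q"
    and "path_weight (weight n (base n)) p = path_weight (weight n (base n)) q \<Longrightarrow>
      path_weight (weight n (shifted n i j k)) p = path_weight (weight n (shifted n i j k)) q"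
proof -
  let ?w = "path_weight (weight n (base n))"
  let ?w' = "path_weight (weight n (shifted n i j k))"
  have bounds: "\<bar>path_weight (base n) r\<bar> \<le> 21 * real n"
    "\<bar>path_weight (shifted n i j k) r\<bar> \<le> 21 * real n" if "tri_path n r" for r
    using base_bound shifted_bound that assms(3) by auto
  have "(?w p < ?w q \<longrightarrow> q \<noteq> [i, j, k] \<longrightarrow> ?w' p < ?w' q) \<and> (?w p = ?w q \<longrightarrow> ?w' p = ?w' q)"
    using span_separated[OF assms(4,5)]
  proof (elim disjE)
    assume "\<exists>x y. p = [x] \<and> q = [y]"
    then show ?thesis by auto
  next
    assume ends: "hd p = hd q \<and> last p = last q"
    have "(path_weight (base n) p < path_weight (base n) q \<longrightarrow> q \<noteq> [i, j, k] \<longrightarrow>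
        path_weight (shifted n i j k) p < path_weight (shifted n i j k) q) \<and>
      (path_weight (base n) p = path_weight (base n) q \<longrightarrow>
        path_weight (shifted n i j k) p = path_weight (shifted n i j k) q)"
      using same_ends_cases[OF assms(4,5) conjunct1[OF ends] conjunct2[OF ends]]
      by (elim disjE exE conjE; use assms(1-3) in \<open>auto simp: small_weights simp del: path_weight_simps\<close>)
    then show ?thesis
      using ends
      by (simp add: path_weight_weight[OF assms(4)] path_weight_weight[OF assms(5)] span_def)
  next
    assume "span p + 1 \<le> span q"
    note less = span_less_imp_weight_less[OF assms(1,4,5) this]
    show ?thesis
      using less[OF bounds(1,1)] less[OF bounds(2,2)] assms(4,5) by simp
  next
    assume "span q + 1 \<le> span p"
    note less = span_less_imp_weight_less[OF assms(1,5,4) this]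
    show ?thesis
      using less[OF bounds(1,1)] less[OF bounds(2,2)] assms(4,5) by simp
  qed
  then show "?w p < ?w q \<Longrightarrow> q \<noteq> [i, j, k] \<Longrightarrow> ?w' p < ?w' q" "?w p = ?w q \<Longrightarrow> ?w' p = ?w' q"
    by auto
qed

section \<open>Betweenness of the middle vertices\<close>

lemma betweenness_base:
  assumes "n \<ge> 1" "n \<le> j" "j < 2 * n"
  shows "betweenness {..<3 * n} (tri_edges n) (weight n (base n)) j = 0"
proof -
  have no_path: "j \<notin> set p"
    if p: "p \<in> shortest_paths {..<3 * n} (tri_edges n) (weight n (base n)) s t"
      and st: "s \<noteq> j" "t \<noteq> j" for s t p
  proof
    assume j: "j \<in> set p"
    have path: "tri_path n p" and ends: "hd p = s" "last p = t"
      and min: "\<And>q. tri_path n q \<Longrightarrow> hd q = s \<Longrightarrow> last q = t \<Longrightarrow>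
        path_weight (weight n (base n)) p \<le> path_weight (weight n (base n)) q"
      using p by (auto simp: shortest_paths_def paths_st_def)
    from path show False
    proof (cases rule: tri_path_cases)
      case (long x y z)
      have xz: "tri_path n [x, z]"
        using long by (intro tri_path_edge) (auto simp: tri_edges_def)
      then have "path_weight (weight n (base n)) [x, y, z] \<le> path_weight (weight n (base n)) [x, z]"
        using min[of "[x, z]"] long ends by simp
      \<comment> \<open>The large terms cancel, leaving \<open>real y\<close> at most 0, whereas y
        is at least n and so positive.\<close>
      then show False
        using long assms by (simp add: weight_def base_def algebra_simps)
    qed (use j ends st in auto)
  qed
  have "num_sp_through {..<3 * n} (tri_edges n) (weight n (base n)) s t j = 0"
    if "s \<noteq> j" "t \<noteq> j" for s t
  proof -
    have "{p \<in> shortest_paths {..<3 * n} (tri_edges n) (weight n (base n)) s t. j \<in> set p} = {}"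
      using no_path that by auto
    then show ?thesis
      unfolding num_sp_through_def by (simp only: card.empty)
  qed
  then show ?thesis
    unfolding betweenness_def by (intro sum.neutral) auto
qed

lemma betweenness_shifted:
  assumes "i < n" "n \<le> j" "j < 2 * n" "2 * n \<le> k" "k < 3 * n"
  shows "betweenness {..<3 * n} (tri_edges n) (weight n (shifted n i j k)) j > 0"
proof -
  let ?w = "weight n (shifted n i j k)"
  let ?S = "shortest_paths {..<3 * n} (tri_edges n) ?w i k"
  let ?P = "{(s, t). s \<in> {..<3 * n} \<and> t \<in> {..<3 * n} \<and> s \<noteq> j \<and> t \<noteq> j \<and>
    paths_st {..<3 * n} (tri_edges n) s t \<noteq> {}}"
  have path: "tri_path n [i, j, k]"
    using assms by (rule tri_path_long)
  have "path_weight ?w [i, j, k] \<le> path_weight ?w q"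
    if q: "tri_path n q" "hd q = i" "last q = k" for q
  proof -
    \<comment> \<open>With equal ends only the small terms matter: i,j,k has -2j, the edge (i,k) has
      0 and the other detours are positive.\<close>
    have "path_weight (shifted n i j k) [i, j, k] \<le> path_weight (shifted n i j k) q"
      using q(1) by (cases rule: tri_path_cases) (use q assms in \<open>auto simp: shifted_def\<close>)
    then show ?thesis
      using q path by (simp only: path_weight_weight) (simp add: span_def)
  qed
  then have mem: "[i, j, k] \<in> ?S"
    using path by (auto simp: shortest_paths_def paths_st_def)
  have fin: "finite ?S"
    by (rule finite_shortest_paths) simp
  have "num_sp {..<3 * n} (tri_edges n) ?w i k > 0"
    unfolding num_sp_def using mem fin by (auto simp: card_gt_0_iff)
  moreover have "num_sp_through {..<3 * n} (tri_edges n) ?w i k j > 0"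
    unfolding num_sp_through_def using mem fin by (auto simp: card_gt_0_iff)
  moreover have "(i, k) \<in> ?P"
  proof -
    have "[i, j, k] \<in> paths_st {..<3 * n} (tri_edges n) i k"
      using path by (simp add: paths_st_def)
    then show ?thesis
      using assms by auto
  qed
  moreover have "finite ?P"
    by (rule finite_subset[of _ "{..<3 * n} \<times> {..<3 * n}"]) auto
  ultimately show ?thesis
    unfolding betweenness_def by (intro sum_pos2[where i = "(i, k)"]) auto
qed

section \<open>The lower bound\<close>

text \<open>Charging each comparison to one path rather than to both gives n^3 instead of n^3/2. The
  value at a tie is arbitrary.\<close>

definition longer :: "(nat \<times> nat \<Rightarrow> real) \<Rightarrow> nat list \<times> nat list \<Rightarrow> nat list" where
  "longer w pq = (if path_weight w (fst pq) < path_weight w (snd pq) then snd pq else fst pq)"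

lemma long_path_queried:
  assumes T: "valid_tree {..<3 * n} (tri_edges n) T" "computes_BC {..<3 * n} (tri_edges n) T"
    and ijk: "i < n" "n \<le> j" "j < 2 * n" "2 * n \<le> k" "k < 3 * n"
  shows "[i, j, k] \<in> longer (weight n (base n)) ` queries T (weight n (base n))"
proof (rule ccontr)
  let ?w = "weight n (base n)"
  let ?w' = "weight n (shifted n i j k)"
  assume notin: "[i, j, k] \<notin> longer ?w ` queries T ?w"
  have n: "n \<ge> 1"
    using ijk by simp
  have "run_tree T ?w = run_tree T ?w'"
  proof (rule run_tree_cong)
    fix p q assume pq: "(p, q) \<in> queries T ?w"
    have paths: "tri_path n p" "tri_path n q"
      using queries_paths[OF T(1) pq] by auto
    have ne: "longer ?w (p, q) \<noteq> [i, j, k]"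
      using notin pq by force
    note order = shifted_preserves_order[OF n ijk(2,3)]
    \<comment> \<open>Preservation is used in both directions, since either path may be the longer
      one; for a tie the choice made by \<open>longer\<close> does not matter.\<close>
    show "(path_weight ?w p < path_weight ?w q \<longleftrightarrow> path_weight ?w' p < path_weight ?w' q) \<and>
        (path_weight ?w p = path_weight ?w q \<longleftrightarrow> path_weight ?w' p = path_weight ?w' q)"
      using order(1)[OF paths, of i k] order(1)[OF paths(2,1), of i k] order(2)[OF paths, of i k] ne
      by (cases "path_weight ?w p" "path_weight ?w q" rule: linorder_cases)
        (auto simp: longer_def)
  qed
  moreover have "run_tree T ?w j = betweenness {..<3 * n} (tri_edges n) ?w j"
    using T(2) pos_weights_weight[OF n base_bound] ijk by (auto simp: computes_BC_def)
  moreover have "run_tree T ?w' j = betweenness {..<3 * n} (tri_edges n) ?w' j"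
    using T(2) pos_weights_weight[OF n shifted_bound[OF _ ijk(3)]] ijk
    by (auto simp: computes_BC_def)
  ultimately show False
    using betweenness_base[OF n ijk(2,3)] betweenness_shifted[OF ijk] by simp
qed

lemma num_comparisons_ge:
  assumes "valid_tree {..<3 * n} (tri_edges n) T" "computes_BC {..<3 * n} (tri_edges n) T"
  shows "n ^ 3 \<le> num_comparisons T (weight n (base n))"
proof -
  let ?w = "weight n (base n)"
  let ?I = "{..<n} \<times> {n..<2 * n} \<times> {2 * n..<3 * n}"
  let ?f = "\<lambda>(i, j, k). [i, j, k]"
  have "n ^ 3 = card ?I"
    by (simp add: power3_eq_cube)
  also have "\<dots> = card (?f ` ?I)"
    by (rule card_image[symmetric]) (auto simp: inj_on_def)
  also have "\<dots> \<le> card (longer ?w ` queries T ?w)"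
    using long_path_queried[OF assms] by (intro card_mono) (auto simp: finite_queries)
  also have "\<dots> \<le> card (queries T ?w)"
    by (rule card_image_le[OF finite_queries])
  also have "\<dots> \<le> num_comparisons T ?w"
    by (rule card_queries_le)
  finally show ?thesis .
qed

theorem theorem2p1:
  fixes n :: nat
  assumes "n \<ge> 1"
  shows "\<exists>(V :: nat set) (E :: (nat \<times> nat) set).
           finite V \<and> card V = 3 * n \<and> E \<subseteq> V \<times> V \<and> (\<forall>x. (x, x) \<notin> E) \<and>
           (\<forall>T. valid_tree V E T \<and> computes_BC V E T \<longrightarrow>
              (\<exists>w. pos_weights E w \<and> real (num_comparisons T w) \<ge> real n ^ 3 / 2))"
proof (intro exI conjI allI impI)
  show "finite {..<3 * n}" "card {..<3 * n} = 3 * n"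
    by auto
  show "tri_edges n \<subseteq> {..<3 * n} \<times> {..<3 * n}" "\<And>x. (x, x) \<notin> tri_edges n"
    by (auto simp: tri_edges_def)
  fix T assume T: "valid_tree {..<3 * n} (tri_edges n) T \<and> computes_BC {..<3 * n} (tri_edges n) T"
  show "pos_weights (tri_edges n) (weight n (base n))"
    by (rule pos_weights_weight[OF assms base_bound])
  have "real (n ^ 3) \<le> real (num_comparisons T (weight n (base n)))"
    using num_comparisons_ge T by (simp only: of_nat_le_iff)
  moreover have "real n ^ 3 \<ge> 0"
    by simp
  ultimately show "real n ^ 3 / 2 \<le> real (num_comparisons T (weight n (base n)))"
    by (simp only: of_nat_power)
qed

end
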